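(* Let $G$ be a finite quiver and let $\varepsilon$ be an oriented edge of $G$ with distinct endpoints. Then $$\omega_c(G)+\omega_c(G_{\bar\varepsilon})+\omega_c(G/\varepsilon)=\frac{\beta_\varepsilon+\beta_{\bar\varepsilon}}{2}\,\omega_c(G_{\setminus\varepsilon}).$$
   Context: All quivers are finite. A quiver $G=(V_G,E_G,\rho_G)$ consists of finite sets $V_G,E_G$ and a map $\rho_G:E_G\to V_G\times V_G$; $\rho_G(\varepsilon)=(u,v)$ means $\varepsilon$ is directed from $u$ to $v$, written $\varepsilon:u\to v$. Parallel edges, directed cycles and tadpoles (edges $u\to u$) are allowed. $G$ is connected if $V_G\neq\emptyset$ and its underlying undirected graph is connected; otherwise it is called disconnected. Acyclic means without directed cycles (a tadpole is a directed cycle). Fix a field $\Bbbk$ of characteristic zero. Each edge $\varepsilon$ carries a parameter $\beta_\varepsilon$; these are independent indeterminates, and graph functions take values in polynomial rings over $\Bbbk$ in the edge parameters. Edges surviving in a subquiver, deletion or contraction keep their parameters. Put $\beta_{\varepsilon,\pm}=(\beta_\varepsilon\pm1)/2$. A cut-subquiver $H\preceq G$ has vertex set $V_G$ and an arbitrary edge subset $E_H\subseteq E_G$. The contraction $G/H$ has as vertices the connected components of $H$ and as edges $E_G\setminus E_H$ with induced incidences (an edge with both endpoints in one component becomes a tadpole). The function $e$: let $E_{\mathrm{tad}}(G)$ be the set of tadpoles and $G_{\mathrm{pruned}}$ the quiver obtained by deleting all tadpoles. For tadpole-free $G$, $e_0(G)=|\operatorname{LE}(G)|/|V_G|!$ if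 $G$ is acyclic ($\operatorname{LE}(G)$ = set of linear extensions of the partial order on $V_G$ induced by the edges), and $e_0(G)=0$ otherwise. In general $e(G)=\bigl(\prod_{\varepsilon\in E_{\mathrm{tad}}(G)}(-\beta_{\varepsilon,-})\bigr)e_0(G_{\mathrm{pruned}})$. The function $\omega$ is the unique function on quivers with $\sum_{H\preceq G}\omega(H)\,e(G/H)=\epsilon(G)$ for all $G$, where $\epsilon(G)=1$ if $E_G=\emptyset$ and $0$ otherwise. The connected function is $\omega_c(G)=\omega(G)$ if $G$ is connected and $\omega_c(G)=0$ otherwise. Local modifications at an edge $\varepsilon:i\to j$ with $i\ne j$: $G_{\bar\varepsilon}$ is obtained by replacing $\varepsilon$ with an edge $\bar\varepsilon:j\to i$ carrying a new independent parameter $\beta_{\bar\varepsilon}$, everything else (including other edges between $i$ and $j$) unchanged; $G_{\setminus\varepsilon}$ is obtained by deleting $\varepsilon$ and keeping all vertices; $G/\varepsilon$ is obtained by removing $\varepsilon$ and identifying $i$ and $j$, keeping every other edge with induced incidence (other edges joining $i$ and $j$ become tadpoles). *)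

theory Defs
  imports "Graph_Theory.Graph_Theory" "HOL-Library.Poly_Mapping"
begin

text \<open>
  A finite quiver is a \<open>pre_digraph\<close> satisfying \<open>fin_digraph\<close>: finitely many vertices and arcs,
  loops and parallel arcs allowed, the null graph included. An arc \<open>\<epsilon>\<close> runs from \<open>tail G \<epsilon>\<close> to
  \<open>head G \<epsilon>\<close>. The library predicate \<open>connected\<close> requires a nonempty vertex set.
\<close>

section \<open>Polynomials in the edge parameters\<close>

text \<open>
  Multivariate polynomials with one indeterminate for every element of \<open>'e\<close>: finitely supported
  maps from monomials (finitely supported exponent functions) to coefficients, with the
  convolution product. The parameter of an edge is determined by the name of the edge, so that it
  is kept under passage to subquivers, deletion and contraction.
\<close>

type_synonym ('e, 'k) edge_poly = "('e \<Rightarrow>\<^sub>0 nat) \<Rightarrow>\<^sub>0 'k"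

definition Const :: "'k::zero \<Rightarrow> ('e, 'k) edge_poly" where
  "Const c = Poly_Mapping.single 0 c"

definition edge_param :: "'e \<Rightarrow> ('e, 'k::zero_neq_one) edge_poly" ("\<beta>") where
  "\<beta> \<epsilon> = Poly_Mapping.single (Poly_Mapping.single \<epsilon> 1) 1"

definition edge_param_minus :: "'e \<Rightarrow> ('e, 'k::field_char_0) edge_poly" ("\<beta>\<^sub>-") where
  "\<beta>\<^sub>- \<epsilon> = Const (1 / 2) * (\<beta> \<epsilon> - 1)"


section \<open>Cut-subquivers, contractions and local modifications\<close>

abbreviation cut_subquiver :: "('v, 'e) pre_digraph \<Rightarrow> ('v, 'e) pre_digraph \<Rightarrow> bool"
    (infix "\<preceq>\<^sub>c" 50) where
  "H \<preceq>\<^sub>c G \<equiv> spanning H G"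

text \<open>
  The connected components of \<open>H\<close> are the strongly connected components of its symmetrisation;
  \<open>scc_of\<close> maps a vertex to its component.
\<close>

definition contract :: "('v, 'e) pre_digraph \<Rightarrow> ('v, 'e) pre_digraph \<Rightarrow> ('v set, 'e) pre_digraph" where
  "contract G H =
     \<lparr> verts = pre_digraph.sccs_verts (with_proj (mk_symmetric H)),
       arcs = arcs G - arcs H,
       tail = (\<lambda>a. pre_digraph.scc_of (with_proj (mk_symmetric H)) (tail G a)),
       head = (\<lambda>a. pre_digraph.scc_of (with_proj (mk_symmetric H)) (head G a)) \<rparr>"

text \<open>
  \<open>G/\<epsilon>\<close>: the vertices are the components of the spanning subquiver with \<open>\<epsilon>\<close> as its only arc, i.e.
  \<open>{tail G \<epsilon>, head G \<epsilon>}\<close> and the singletons of the other vertices.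
\<close>

definition contract_arc :: "('v, 'e) pre_digraph \<Rightarrow> 'e \<Rightarrow> ('v set, 'e) pre_digraph" where
  "contract_arc G \<epsilon> = contract G (G\<lparr>arcs := {\<epsilon>}\<rparr>)"

definition reverse_arc :: "('v, 'e) pre_digraph \<Rightarrow> 'e \<Rightarrow> 'e \<Rightarrow> ('v, 'e) pre_digraph" where
  "reverse_arc G \<epsilon> \<epsilon>' =
     \<lparr> verts = verts G,
       arcs = insert \<epsilon>' (arcs G - {\<epsilon>}),
       tail = (tail G)(\<epsilon>' := head G \<epsilon>),
       head = (head G)(\<epsilon>' := tail G \<epsilon>) \<rparr>"


section \<open>The function \<open>e\<close>\<close>

definition tadpoles :: "('v, 'e) pre_digraph \<Rightarrow> 'e set" where
  "tadpoles G = {\<epsilon> \<in> arcs G. tail G \<epsilon> = head G \<epsilon>}"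

definition pruned :: "('v, 'e) pre_digraph \<Rightarrow> ('v, 'e) pre_digraph" where
  "pruned G = G\<lparr>arcs := arcs G - tadpoles G\<rparr>"

definition linear_extensions :: "('v, 'e) pre_digraph \<Rightarrow> 'v rel set" where
  "linear_extensions G =
     {r. linear_order_on (verts G) r \<and> {(u, v). u \<rightarrow>\<^sup>*\<^bsub>G\<^esub> v} \<subseteq> r}"

definition e0 :: "('v, 'e) pre_digraph \<Rightarrow> ('e, 'k::field_char_0) edge_poly" where
  "e0 G = (if acyclic (arcs_ends G)
           then Const (of_nat (card (linear_extensions G)) / fact (card (verts G)))
           else 0)"

definition e_fun :: "('v, 'e) pre_digraph \<Rightarrow> ('e, 'k::field_char_0) edge_poly" where
  "e_fun G = (\<Prod>\<epsilon>\<in>tadpoles G. - \<beta>\<^sub>- \<epsilon>) * e0 (pruned G)"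


section \<open>The functions \<open>\<omega>\<close> and \<open>\<omega>\<^sub>c\<close>\<close>

definition counit :: "('v, 'e) pre_digraph \<Rightarrow> ('e, 'k::field_char_0) edge_poly" where
  "counit G = (if arcs G = {} then 1 else 0)"

text \<open>
  Cut-subquivers of \<open>G\<close> have the vertex set of \<open>G\<close>, so for each vertex type separately the
  defining equations are a closed system for the values of \<open>\<omega>\<close>. Records that are not finite
  quivers get the value \<open>0\<close>.
\<close>

definition is_omega :: "(('v, 'e) pre_digraph \<Rightarrow> ('e, 'k::field_char_0) edge_poly) \<Rightarrow> bool" where
  "is_omega w \<longleftrightarrow>
     (\<forall>G. fin_digraph G \<longrightarrow> (\<Sum>H | H \<preceq>\<^sub>c G. w H * e_fun (contract G H)) = counit G) \<and>
     (\<forall>G. \<not> fin_digraph G \<longrightarrow> w G = 0)"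

definition omega :: "('v, 'e) pre_digraph \<Rightarrow> ('e, 'k::field_char_0) edge_poly" ("\<omega>") where
  "\<omega> = (THE w. is_omega w)"

definition omega_c :: "('v, 'e) pre_digraph \<Rightarrow> ('e, 'k::field_char_0) edge_poly" ("\<omega>\<^sub>c") where
  "\<omega>\<^sub>c G = (if Digraph_Component.connected G then \<omega> G else 0)"


section \<open>Existence and uniqueness of \<open>\<omega>\<close>\<close>

lemma cut_subquivers_eq:
  assumes "fin_digraph G"
  shows "{H. H \<preceq>\<^sub>c G} = (\<lambda>F. G\<lparr>arcs := F\<rparr>) ` Pow (arcs G)"
proof -
  interpret fin_digraph G by fact
  show ?thesis
  proof (intro set_eqI iffI)
    fix H assume "H \<in> {H. H \<preceq>\<^sub>c G}"
    then have "H = G\<lparr>arcs := arcs H\<rparr>" "arcs H \<subseteq> arcs G"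
      by (auto simp: spanning_def subgraph_def compatible_def)
    then show "H \<in> (\<lambda>F. G\<lparr>arcs := F\<rparr>) ` Pow (arcs G)" by blast
  next
    fix H assume "H \<in> (\<lambda>F. G\<lparr>arcs := F\<rparr>) ` Pow (arcs G)"
    then obtain F where F: "F \<subseteq> arcs G" "H = G\<lparr>arcs := F\<rparr>" by auto
    have "wf_digraph H" using F by unfold_locales auto
    then show "H \<in> {H. H \<preceq>\<^sub>c G}"
      using F wf_digraph by (auto simp: spanning_def subgraph_def compatible_def)
  qed
qed

lemma finite_cut_subquivers:
  assumes "fin_digraph G"
  shows "finite {H. H \<preceq>\<^sub>c G}"
  unfolding cut_subquivers_eq[OF assms] using fin_digraph.finite_arcs[OF assms] by simp

lemma fin_digraph_cut_subquiver:
  assumes "fin_digraph G" "H \<preceq>\<^sub>c G"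
  shows "fin_digraph H"
proof -
  interpret fin_digraph G by fact
  have "wf_digraph H" "verts H = verts G" "arcs H \<subseteq> arcs G"
    using assms(2) by (auto simp: spanning_def subgraph_def)
  moreover from this have "finite (verts H)" "finite (arcs H)"
    by (simp_all add: finite_subset[OF _ finite_arcs])
  ultimately show ?thesis by (intro wf_digraph.fin_digraphI)
qed

lemma card_arcs_cut_subquiver:
  assumes "fin_digraph G" "H \<preceq>\<^sub>c G" "H \<noteq> G"
  shows "card (arcs H) < card (arcs G)"
proof -
  interpret fin_digraph G by fact
  have "arcs H \<noteq> arcs G" and "arcs H \<subseteq> arcs G"
    using assms(2,3) by (auto simp: spanning_def subgraph_def compatible_def)
  then show ?thesis by (intro psubset_card_mono) auto
qed

lemma linear_extensions_arcless:
  assumes "arcs G = {}"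
  shows "linear_extensions G = {r. linear_order_on (verts G) r}"
proof -
  have "u = v \<and> u \<in> verts G" if "u \<rightarrow>\<^sup>*\<^bsub>G\<^esub> v" for u v
    using that assms unfolding reachable_def
    by (induct rule: rtrancl_on_induct) (auto simp: arcs_ends_def)
  then show ?thesis
    by (auto simp: linear_extensions_def order_on_defs refl_on_def)
qed

lemma e_fun_arcless_unit:
  fixes G :: "('v, 'e) pre_digraph"
  assumes "finite (verts G)" "arcs G = {}"
  obtains i where "(e_fun G :: ('e, 'k::field_char_0) edge_poly) * i = 1"
proof -
  let ?L = "{r. linear_order_on (verts G) r}"
  have "?L \<subseteq> Pow (verts G \<times> verts G)"
    by (auto simp: order_on_defs)
  then have "finite ?L"
    using assms(1) by (metis finite_Pow_iff finite_SigmaI finite_subset)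
  moreover have "?L \<noteq> {}"
    using well_order_on[of "verts G"] by (auto simp: well_order_on_def)
  ultimately have "card ?L \<noteq> 0" by simp
  moreover define c where "c = of_nat (card ?L) / (fact (card (verts G)) :: 'k)"
  ultimately have "c \<noteq> 0" by simp
  have [simp]: "pruned G = G" "tadpoles G = {}"
    using assms(2) by (auto simp: pruned_def tadpoles_def)
  have "(e_fun G :: ('e, 'k) edge_poly) = Const c"
    using assms(2) by (simp add: e_fun_def e0_def linear_extensions_arcless c_def arcs_ends_def acyclic_def)
  then have "(e_fun G :: ('e, 'k) edge_poly) * Const (1 / c) = 1"
    using \<open>c \<noteq> 0\<close> by (simp add: Const_def mult_single)
  then show thesis by (rule that)
qed

lemma e_fun_contract_self_unit:
  fixes G :: "('v, 'e) pre_digraph"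
  assumes "fin_digraph G"
  obtains i where "(e_fun (contract G G) :: ('e, 'k::field_char_0) edge_poly) * i = 1"
proof -
  interpret fin_digraph G by fact
  interpret S: pair_fin_digraph "mk_symmetric G" ..
  show thesis
    by (rule e_fun_arcless_unit[where G = "contract G G", OF _ _ that])
       (auto simp: contract_def S.finite_sccs_verts)
qed

lemma sum_cut_subquivers_split:
  assumes "fin_digraph G"
  shows "(\<Sum>H | H \<preceq>\<^sub>c G. f H) = (f G :: 'a::comm_monoid_add) + (\<Sum>H | H \<preceq>\<^sub>c G \<and> H \<noteq> G. f H)"
proof -
  interpret fin_digraph G by fact
  have "G \<preceq>\<^sub>c G" by (simp add: spanning_def subgraph_refl)
  moreover have "{H. H \<preceq>\<^sub>c G} - {G} = {H. H \<preceq>\<^sub>c G \<and> H \<noteq> G}" by auto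
  ultimately show ?thesis
    using sum.remove[of "{H. H \<preceq>\<^sub>c G}" G f] finite_cut_subquivers[OF assms] by simp
qed

lemma ex1_omega: "\<exists>!w :: ('v, 'e) pre_digraph \<Rightarrow> ('e, 'k::field_char_0) edge_poly. is_omega w"
proof (rule ex_ex1I)
  let ?P = "\<lambda>(f :: ('v, 'e) pre_digraph \<Rightarrow> ('e, 'k) edge_poly) G r.
    if fin_digraph G
    then r * e_fun (contract G G) + (\<Sum>H | H \<preceq>\<^sub>c G \<and> H \<noteq> G. f H * e_fun (contract G H)) = counit G
    else r = 0"
  have "\<exists>f. \<forall>G. ?P f G (f G)"
  proof (rule dependent_wf_choice[where R = "measure (\<lambda>G. card (arcs G))"], goal_cases)
    case 1
    show ?case by simp
  next
    case (2 f g G r)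
    have "(\<Sum>H | H \<preceq>\<^sub>c G \<and> H \<noteq> G. f H * e_fun (contract G H))
        = (\<Sum>H | H \<preceq>\<^sub>c G \<and> H \<noteq> G. g H * e_fun (contract G H))" if "fin_digraph G"
      using 2 card_arcs_cut_subquiver[OF that] by (intro sum.cong) auto
    then show ?case by simp
  next
    case (3 G f)
    show ?case
    proof (cases "fin_digraph G")
      case True
      then obtain i where i: "(e_fun (contract G G) :: ('e, 'k) edge_poly) * i = 1"
        by (rule e_fun_contract_self_unit)
      let ?S = "\<Sum>H | H \<preceq>\<^sub>c G \<and> H \<noteq> G. f H * e_fun (contract G H)"
      have "((counit G - ?S) * i) * e_fun (contract G G) + ?S = counit G"
        using i by (simp add: mult.assoc mult.commute[of i])
      with True show ?thesis by auto
    qed auto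
  qed
  then obtain w where w: "\<And>G. ?P w G (w G)" by blast
  have "(\<Sum>H | H \<preceq>\<^sub>c G. w H * e_fun (contract G H)) = counit G" if "fin_digraph G" for G
    using w[of G] that by (simp add: sum_cut_subquivers_split)
  moreover have "w G = 0" if "\<not> fin_digraph G" for G
    using w[of G] that by simp
  ultimately show "\<exists>w :: ('v, 'e) pre_digraph \<Rightarrow> ('e, 'k) edge_poly. is_omega w"
    unfolding is_omega_def by blast
next
  fix w w' :: "('v, 'e) pre_digraph \<Rightarrow> ('e, 'k) edge_poly"
  assume w: "is_omega w" and w': "is_omega w'"
  have "w G = w' G" for G
  proof (induct G rule: measure_induct_rule[where f = "\<lambda>G. card (arcs G)"])
    case (less G)
    show ?case
    proof (cases "fin_digraph G")
      case True
      then obtain i where i: "(e_fun (contract G G) :: ('e, 'k) edge_poly) * i = 1"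
        by (rule e_fun_contract_self_unit)
      have "(\<Sum>H | H \<preceq>\<^sub>c G \<and> H \<noteq> G. w H * e_fun (contract G H))
          = (\<Sum>H | H \<preceq>\<^sub>c G \<and> H \<noteq> G. w' H * e_fun (contract G H))"
        using less card_arcs_cut_subquiver[OF True] by (intro sum.cong) auto
      moreover have "(\<Sum>H | H \<preceq>\<^sub>c G. w H * e_fun (contract G H)) = (\<Sum>H | H \<preceq>\<^sub>c G. w' H * e_fun (contract G H))"
        using w w' True by (simp add: is_omega_def)
      ultimately have "w G * e_fun (contract G G) = w' G * e_fun (contract G G)"
        by (simp add: sum_cut_subquivers_split[OF True])
      then have "w G * (e_fun (contract G G) * i) = w' G * (e_fun (contract G G) * i)"
        by (simp flip: mult.assoc)
      then show ?thesis by (simp add: i)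
    qed (use w w' in \<open>simp add: is_omega_def\<close>)
  qed
  then show "w = w'" by blast
qed

lemma is_omega_omega: "is_omega \<omega>"
  unfolding omega_def using theI'[OF ex1_omega] .

end

theory Submission
  imports Defs
begin

text \<open>
  Write \<open>i\<close> and \<open>j\<close> for the endpoints of \<open>\<epsilon>\<close>, \<open>R\<close> for the quiver with \<open>\<epsilon>\<close> reversed to \<open>\<epsilon>'\<close>,
  \<open>Q = G/\<epsilon>\<close>, \<open>D\<close> for \<open>G\<close> without \<open>\<epsilon>\<close>, and \<open>c = (\<beta> \<epsilon> + \<beta> \<epsilon>')/2\<close>. The relation proved is one for
  \<open>\<omega>\<close> itself (\<open>omega_arc_relation\<close>): \<open>\<omega> G + \<omega> R + \<omega> Q\<close> equals \<open>c * \<omega> D\<close> if \<open>i\<close> and \<open>j\<close> are joined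
  by an undirected path in \<open>D\<close>, and \<open>0\<close> otherwise. The relation for \<open>\<omega>\<^sub>c\<close> follows, because \<open>G\<close>, \<open>R\<close>
  and \<open>Q\<close> are connected simultaneously, while \<open>D\<close> is connected iff \<open>G\<close> is and \<open>D\<close> joins \<open>i\<close> to \<open>j\<close>.

  The relation for \<open>\<omega>\<close> is proved by induction on the number of arcs. For a set \<open>F\<close> of arcs of \<open>D\<close>,
  identify \<open>F\<close> with the cut-subquiver that it spans, and let \<open>X F\<close> be the difference of the two
  sides of the relation for the cut-subquiver \<open>F + \<epsilon>\<close> of \<open>G\<close>. Adding the equations that define
  \<open>\<omega>\<close> at \<open>G\<close>, \<open>R\<close> and \<open>Q\<close>, and subtracting the one at \<open>D\<close>, gives
  \<open>(\<Sum>F. X F * e(G/(F + \<epsilon>))) = 0\<close>. By the induction hypothesis only the term of the full set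
  survives, and its factor \<open>e(G/G)\<close> is invertible.

  The four equations combine in this way because of two facts. The contractions \<open>Q/F\<close> and
  \<open>R/(F + \<epsilon>')\<close> are isomorphic to \<open>G/(F + \<epsilon>)\<close> (\<open>e_fun_contract_contract\<close>,
  \<open>e_fun_contract_reverse_arc\<close>). And \<open>e(G/F) + e(R/F)\<close> is \<open>e(D/F)\<close> if \<open>F\<close> does not join \<open>i\<close> to \<open>j\<close>,
  since every linear extension of \<open>D/F\<close> puts the two endpoints in exactly one of the two orders;
  otherwise \<open>\<epsilon>\<close> and \<open>\<epsilon>'\<close> become tadpoles, \<open>e(G/F) + e(R/F) = (1 - c) * e(D/F)\<close>, and
  \<open>D/F\<close> is isomorphic to \<open>G/(F + \<epsilon>)\<close> (\<open>e_fun_contract_sum\<close>).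
\<close>

section \<open>Connectivity and contractions\<close>

text \<open>Both vertices lie in \<open>G\<close> and are joined by a path that ignores the directions of the arcs.\<close>

abbreviation linked :: "('v, 'e) pre_digraph \<Rightarrow> 'v \<Rightarrow> 'v \<Rightarrow> bool" where
  "linked G u v \<equiv> u \<rightarrow>\<^sup>*\<^bsub>with_proj (mk_symmetric G)\<^esub> v"

text \<open>The vertex set of the connected component of a vertex; empty outside \<open>verts G\<close>.\<close>

abbreviation component :: "('v, 'e) pre_digraph \<Rightarrow> 'v \<Rightarrow> 'v set" where
  "component G \<equiv> pre_digraph.scc_of (with_proj (mk_symmetric G))"

lemma wf_digraph_mk_symmetric: "wf_digraph G \<Longrightarrow> wf_digraph (with_proj (mk_symmetric G))"
  by (auto simp: wf_digraph_def parcs_mk_symmetric)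

lemma linked_refl: "u \<in> verts G \<Longrightarrow> linked G u u"
  by (simp add: reachable_def)

lemma linked_in_verts:
  "linked G u v \<Longrightarrow> u \<in> verts G"
  "linked G u v \<Longrightarrow> v \<in> verts G"
  unfolding reachable_def by (auto dest: in_rtrancl_on_in_F)

lemma linked_trans: "linked G u v \<Longrightarrow> linked G v w \<Longrightarrow> linked G u w"
  unfolding reachable_def by (rule rtrancl_on_trans)

lemma linked_arc:
  assumes "wf_digraph G" "a \<in> arcs G"
  shows "linked G (tail G a) (head G a)" "linked G (head G a) (tail G a)"
proof -
  interpret wf_digraph G by fact
  show "linked G (tail G a) (head G a)" "linked G (head G a) (tail G a)"
    unfolding reachable_def using assms(2)
    by (auto intro!: rtrancl_on_into_rtrancl_on[OF rtrancl_on_refl] simp: parcs_mk_symmetric)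
qed

lemma linked_induct:
  assumes "linked G u v" "P u" "\<And>a. a \<in> arcs G \<Longrightarrow> P (tail G a) \<longleftrightarrow> P (head G a)"
  shows "P v"
  using assms(1) unfolding reachable_def
  by (induct rule: rtrancl_on_induct) (use assms(2,3) in \<open>auto simp: parcs_mk_symmetric\<close>)

lemma linked_sym:
  assumes "wf_digraph G" "linked G u v"
  shows "linked G v u"
  using assms(2)
proof (rule linked_induct[where P = "\<lambda>w. linked G w u"])
  show "linked G u u" using linked_in_verts(1)[OF assms(2)] by (rule linked_refl)
next
  fix a assume "a \<in> arcs G"
  then show "linked G (tail G a) u \<longleftrightarrow> linked G (head G a) u"
    using linked_arc[OF assms(1)] linked_trans by metis
qed

lemma linked_cong_right:
  assumes "wf_digraph G" "linked G x y"
  shows "linked G u x \<longleftrightarrow> linked G u y"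
  using assms(2) linked_sym[OF assms] linked_trans[of G] by blast

lemma linked_mono:
  assumes "linked G u v" "wf_digraph H" "verts H = verts G"
    and "\<And>a. a \<in> arcs G \<Longrightarrow> linked H (tail G a) (head G a)"
  shows "linked H u v"
  using assms(1)
proof (rule linked_induct)
  show "linked H u u" using linked_in_verts(1)[OF assms(1)] by (intro linked_refl) (simp add: assms(3))
qed (rule linked_cong_right[OF assms(2,4)])

lemma wf_digraph_cut: "wf_digraph G \<Longrightarrow> A \<subseteq> arcs G \<Longrightarrow> wf_digraph (G\<lparr>arcs := A\<rparr>)"
  unfolding wf_digraph_def by auto

lemma fin_digraph_cut: "fin_digraph G \<Longrightarrow> A \<subseteq> arcs G \<Longrightarrow> fin_digraph (G\<lparr>arcs := A\<rparr>)"
  unfolding fin_digraph_def fin_digraph_axioms_def wf_digraph_def by (auto intro: finite_subset)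

lemma linked_cut_mono:
  assumes "wf_digraph G" "A \<subseteq> B" "B \<subseteq> arcs G" "linked (G\<lparr>arcs := A\<rparr>) u v"
  shows "linked (G\<lparr>arcs := B\<rparr>) u v"
proof -
  have wf: "wf_digraph (G\<lparr>arcs := B\<rparr>)" by (rule wf_digraph_cut) fact+
  show ?thesis
    by (rule linked_mono[OF assms(4) wf]) (use linked_arc(1)[OF wf] assms(2) in auto)
qed

lemma linked_insert_redundant:
  assumes "wf_digraph G" "A \<subseteq> arcs G" "a \<in> arcs G"
    and "linked (G\<lparr>arcs := A\<rparr>) (tail G a) (head G a)"
  shows "linked (G\<lparr>arcs := insert a A\<rparr>) u v \<longleftrightarrow> linked (G\<lparr>arcs := A\<rparr>) u v"
proof
  show "linked (G\<lparr>arcs := insert a A\<rparr>) u v" if "linked (G\<lparr>arcs := A\<rparr>) u v"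
    by (rule linked_cut_mono[OF assms(1) _ _ that]) (use assms(2,3) in auto)
  have wf: "wf_digraph (G\<lparr>arcs := A\<rparr>)" by (rule wf_digraph_cut) fact+
  show "linked (G\<lparr>arcs := A\<rparr>) u v" if "linked (G\<lparr>arcs := insert a A\<rparr>) u v"
    by (rule linked_mono[OF that wf]) (use linked_arc(1)[OF wf] assms(4) in auto)
qed

lemma component_eq_iff:
  assumes "wf_digraph G" "v \<in> verts G"
  shows "component G u = component G v \<longleftrightarrow> linked G u v"
proof
  assume "component G u = component G v"
  moreover have "v \<in> component G v"
    using linked_refl[OF assms(2)] by (simp add: pre_digraph.scc_of_def)
  ultimately have "v \<in> component G u" by simp
  then show "linked G u v" by (simp add: pre_digraph.scc_of_def)
next
  assume "linked G u v"
  then have "linked G w u \<longleftrightarrow> linked G w v" "linked G u w \<longleftrightarrow> linked G v w" for w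
    using linked_cong_right[OF assms(1)] linked_sym[OF assms(1)] by metis+
  then show "component G u = component G v"
    by (simp add: pre_digraph.scc_of_def)
qed

lemma sccs_verts_eq_components:
  assumes "wf_digraph G"
  shows "pre_digraph.sccs_verts (with_proj (mk_symmetric G)) = component G ` verts G"
proof (intro set_eqI iffI)
  fix S assume "S \<in> component G ` verts G"
  then show "S \<in> pre_digraph.sccs_verts (with_proj (mk_symmetric G))"
    using wf_digraph.scc_of_in_sccs_verts[OF wf_digraph_mk_symmetric[OF assms]] by auto
next
  fix S assume S: "S \<in> pre_digraph.sccs_verts (with_proj (mk_symmetric G))"
  then obtain u where u: "u \<in> S" unfolding pre_digraph.sccs_verts_def by auto
  have S1: "linked G u v \<and> linked G v u" if "v \<in> S" for v
    using S u that by (simp add: pre_digraph.sccs_verts_def)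
  have S2: "v \<in> S" if "linked G u v" "linked G v u" for v
    using S u that by (auto simp: pre_digraph.sccs_verts_def)
  have "S = component G u"
    unfolding pre_digraph.scc_of_def by (intro set_eqI iffI CollectI S1) (simp_all add: S2)
  moreover have "u \<in> verts G" using S1[OF u] linked_in_verts(1) by metis
  ultimately show "S \<in> component G ` verts G" by simp
qed

lemma verts_contract:
  assumes "wf_digraph G" "A \<subseteq> arcs G"
  shows "verts (contract G (G\<lparr>arcs := A\<rparr>)) = component (G\<lparr>arcs := A\<rparr>) ` verts G"
  using sccs_verts_eq_components[OF wf_digraph_cut[OF assms]] by (simp add: contract_def)

lemma fin_digraph_contract:
  assumes "fin_digraph G" "A \<subseteq> arcs G"
  shows "fin_digraph (contract G (G\<lparr>arcs := A\<rparr>))"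
proof -
  interpret fin_digraph G by fact
  note v = verts_contract[OF wf_digraph_axioms assms(2)]
  show ?thesis
    by unfold_locales (simp_all add: v, simp_all add: contract_def)
qed

text \<open>
  The quiver \<open>G/A\<close> with arc set \<open>B\<close> joins two components of \<open>A\<close> iff \<open>A \<union> B\<close> joins their members: the
  arcs of \<open>A\<close> move inside the components that the contraction collapses.
\<close>

lemma linked_contract_iff:
  assumes "wf_digraph G" "A \<subseteq> arcs G" "B \<subseteq> arcs G - A" "u \<in> verts G" "v \<in> verts G"
  shows "linked ((contract G (G\<lparr>arcs := A\<rparr>))\<lparr>arcs := B\<rparr>)
           (component (G\<lparr>arcs := A\<rparr>) u) (component (G\<lparr>arcs := A\<rparr>) v)
         \<longleftrightarrow> linked (G\<lparr>arcs := A \<union> B\<rparr>) u v"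
proof
  let ?C = "component (G\<lparr>arcs := A\<rparr>)"
  let ?Q = "(contract G (G\<lparr>arcs := A\<rparr>))\<lparr>arcs := B\<rparr>"
  let ?U = "G\<lparr>arcs := A \<union> B\<rparr>"
  interpret wf_digraph G by fact
  have wfA: "wf_digraph (G\<lparr>arcs := A\<rparr>)" and wfU: "wf_digraph ?U"
    using assms by (auto intro!: wf_digraph_cut)
  have th: "tail ?Q a = ?C (tail G a)" "head ?Q a = ?C (head G a)" for a
    by (simp_all add: contract_def)
  have vQ: "verts ?Q = ?C ` verts G"
    using verts_contract[OF assms(1,2)] by simp
  have wfQ: "wf_digraph ?Q"
    using assms(3) unfolding wf_digraph_def th vQ by auto
  have C: "?C x = ?C y \<longleftrightarrow> linked (G\<lparr>arcs := A\<rparr>) x y" if "y \<in> verts G" for x y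
    using component_eq_iff[OF wfA] that by simp
  have AU: "linked ?U x y" if "linked (G\<lparr>arcs := A\<rparr>) x y" for x y
    by (rule linked_cut_mono[OF assms(1) _ _ that]) (use assms(2,3) in auto)
  have BV: "tail G a \<in> verts G" "head G a \<in> verts G" if "a \<in> B" for a
    using that assms(3) by auto
  {
    assume "linked ?Q (?C u) (?C v)"
    then have "\<forall>w\<in>verts G. ?C w = ?C v \<longrightarrow> linked ?U u w"
    proof (rule linked_induct)
      show "\<forall>w\<in>verts G. ?C w = ?C u \<longrightarrow> linked ?U u w"
        using C AU by metis
    next
      fix a assume "a \<in> arcs ?Q"
      then have a: "a \<in> B" by simp
      have l: "linked ?U (tail G a) (head G a)"
        using linked_arc(1)[OF wfU, of a] a by auto
      have *: "(\<forall>w\<in>verts G. ?C w = ?C x \<longrightarrow> linked ?U u w) \<longleftrightarrow> linked ?U u x"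
        if "x \<in> verts G" for x
      proof (intro iffI ballI impI)
        show "linked ?U u x" if "\<forall>w\<in>verts G. ?C w = ?C x \<longrightarrow> linked ?U u w"
          using that \<open>x \<in> verts G\<close> by simp
        fix w assume w: "w \<in> verts G" "?C w = ?C x" "linked ?U u x"
        from w(1,2) have "linked ?U x w" using C[of w x] AU by (metis C)
        with w(3) show "linked ?U u w" by (rule linked_trans)
      qed
      show "(\<forall>w\<in>verts G. ?C w = tail ?Q a \<longrightarrow> linked ?U u w) \<longleftrightarrow>
            (\<forall>w\<in>verts G. ?C w = head ?Q a \<longrightarrow> linked ?U u w)"
        unfolding th *[OF BV(1)[OF a]] *[OF BV(2)[OF a]] by (rule linked_cong_right[OF wfU l])
    qed
    then show "linked ?U u v" using assms(5) by blast
  }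
  assume "linked ?U u v"
  then show "linked ?Q (?C u) (?C v)"
  proof (rule linked_induct)
    show "linked ?Q (?C u) (?C u)" using assms(4) by (intro linked_refl) (simp add: vQ[simplified])
  next
    fix a assume "a \<in> arcs ?U"
    then consider "a \<in> A" | "a \<in> B" by auto
    then show "linked ?Q (?C u) (?C (tail ?U a)) \<longleftrightarrow> linked ?Q (?C u) (?C (head ?U a))"
    proof cases
      case 1
      have "head G a \<in> verts G" "linked (G\<lparr>arcs := A\<rparr>) (tail G a) (head G a)"
        using linked_arc(1)[OF wfA, of a] 1 assms(2) by auto
      then have "?C (tail G a) = ?C (head G a)" by (rule C[THEN iffD2])
      then show ?thesis by simp
    next
      case 2
      then show ?thesis
        using linked_cong_right[OF wfQ linked_arc(1)[OF wfQ, of a]] unfolding th by simp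
    qed
  qed
qed

section \<open>The function \<open>e\<close>\<close>

text \<open>
  The linear orders on the vertices that contain all arcs. Tadpoles impose no condition, and if
  some directed cycle has at least two vertices there are no such orders.
\<close>

definition compatible_orders :: "('v, 'e) pre_digraph \<Rightarrow> 'v rel set" where
  "compatible_orders G =
     {r. linear_order_on (verts G) r \<and> (\<forall>a\<in>arcs G. (tail G a, head G a) \<in> r)}"

lemma compatible_order_subset: "r \<in> compatible_orders G \<Longrightarrow> r \<subseteq> verts G \<times> verts G"
  by (simp add: compatible_orders_def order_on_defs)

lemma compatible_order_refl: "r \<in> compatible_orders G \<Longrightarrow> u \<in> verts G \<Longrightarrow> (u, u) \<in> r"
  by (simp add: compatible_orders_def order_on_defs refl_on_def)

lemma compatible_order_trans: "r \<in> compatible_orders G \<Longrightarrow> trans r"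
  by (simp add: compatible_orders_def order_on_defs)

lemma compatible_order_antisym: "r \<in> compatible_orders G \<Longrightarrow> antisym r"
  by (simp add: compatible_orders_def order_on_defs)

lemma finite_compatible_orders: "finite (verts G) \<Longrightarrow> finite (compatible_orders G)"
  using compatible_order_subset[of _ G]
  by (intro finite_subset[of "compatible_orders G" "Pow (verts G \<times> verts G)"]) auto

lemma linear_extensions_eq_compatible_orders:
  assumes "wf_digraph G"
  shows "linear_extensions G = compatible_orders G"
proof -
  interpret wf_digraph G by fact
  have "(tail G a, head G a) \<in> {(u, v). u \<rightarrow>\<^sup>*\<^bsub>G\<^esub> v}" if "a \<in> arcs G" for a
    using that by (auto intro: reachable_adjI in_arcs_imp_in_arcs_ends)
  moreover have "(u, v) \<in> r" if "r \<in> compatible_orders G" "u \<rightarrow>\<^sup>*\<^bsub>G\<^esub> v" for r u v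
    using that(2) unfolding reachable_def
  proof (induct rule: rtrancl_on_induct)
    case base
    then show ?case by (rule compatible_order_refl[OF that(1)])
  next
    case (step x y)
    from step(2) have "(x, y) \<in> r" using that(1) by (auto simp: compatible_orders_def arcs_ends_conv)
    with step(5) show ?case by (rule transD[OF compatible_order_trans[OF that(1)]])
  qed
  ultimately show ?thesis
    unfolding linear_extensions_def compatible_orders_def by blast
qed

lemma compatible_orders_pruned:
  assumes "wf_digraph G"
  shows "compatible_orders (pruned G) = compatible_orders G"
proof -
  interpret wf_digraph G by fact
  have "(tail G a, head G a) \<in> r" if "linear_order_on (verts G) r" "a \<in> tadpoles G" for r a
    using that by (auto simp: tadpoles_def order_on_defs refl_on_def)
  then show ?thesis
    unfolding compatible_orders_def pruned_def by auto
qed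

lemma acyclic_if_compatible_order:
  assumes "wf_digraph G" "tadpoles G = {}" "r \<in> compatible_orders G"
  shows "acyclic (arcs_ends G)"
proof -
  have "arcs_ends G \<subseteq> r - Id"
    using assms(2,3) by (auto simp: compatible_orders_def tadpoles_def arcs_ends_conv)
  moreover have "acyclic (r - Id)"
    using trans_diff_Id[OF compatible_order_trans compatible_order_antisym, OF assms(3) assms(3)]
    by (simp add: acyclic_def trancl_id)
  ultimately show ?thesis by (rule acyclic_subset[rotated])
qed

text \<open>
  Counting compatible orders gives the right value for every quiver, without distinguishing whether
  the pruned quiver is acyclic: if it is not, there is nothing to count.
\<close>

lemma e_fun_eq:
  assumes "wf_digraph G"
  shows "e_fun G = (\<Prod>\<epsilon>\<in>tadpoles G. - \<beta>\<^sub>- \<epsilon>) *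
     Const (of_nat (card (compatible_orders G)) / fact (card (verts G)))"
proof -
  have wf: "wf_digraph (pruned G)"
    unfolding pruned_def by (rule wf_digraph_cut[OF assms]) auto
  have "tadpoles (pruned G) = {}" by (auto simp: tadpoles_def pruned_def)
  from acyclic_if_compatible_order[OF wf this]
  have "compatible_orders G = {}" if "\<not> acyclic (arcs_ends (pruned G))"
    using that compatible_orders_pruned[OF assms] by auto
  then show ?thesis
    using linear_extensions_eq_compatible_orders[OF wf] compatible_orders_pruned[OF assms]
    by (auto simp: e_fun_def e0_def Const_def pruned_def)
qed

lemma linear_order_on_image:
  assumes "linear_order_on A r" "inj_on f A"
  shows "linear_order_on (f ` A) (map_prod f f ` r)"
proof -
  have r: "r \<subseteq> A \<times> A" "\<And>x. x \<in> A \<Longrightarrow> (x, x) \<in> r" "trans r" "antisym r"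
    "\<And>x y. x \<in> A \<Longrightarrow> y \<in> A \<Longrightarrow> x \<noteq> y \<Longrightarrow> (x, y) \<in> r \<or> (y, x) \<in> r"
    using assms(1) by (simp_all add: order_on_defs refl_on_def total_on_def)
  have m: "(f x, f y) \<in> map_prod f f ` r \<longleftrightarrow> (x, y) \<in> r" if "x \<in> A" "y \<in> A" for x y
  proof
    assume "(f x, f y) \<in> map_prod f f ` r"
    then obtain x' y' where x'y': "(x', y') \<in> r" "f x = f x'" "f y = f y'" by auto
    moreover from this r(1) have "x' \<in> A" "y' \<in> A" by auto
    ultimately have "x = x'" "y = y'" using assms(2) that by (auto dest: inj_onD)
    with x'y' show "(x, y) \<in> r" by simp
  qed (rule rev_image_eqI, assumption, simp)
  have s: "map_prod f f ` r \<subseteq> f ` A \<times> f ` A" using r(1) by auto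
  have "trans (map_prod f f ` r)"
  proof (rule transI)
    fix a b c assume ab: "(a, b) \<in> map_prod f f ` r" "(b, c) \<in> map_prod f f ` r"
    with s obtain x y z where xyz: "x \<in> A" "y \<in> A" "z \<in> A" "a = f x" "b = f y" "c = f z" by blast
    with ab m have "(x, y) \<in> r" "(y, z) \<in> r" by auto
    then have "(x, z) \<in> r" by (rule transD[OF r(3)])
    then show "(a, c) \<in> map_prod f f ` r" using m xyz by simp
  qed
  moreover have "antisym (map_prod f f ` r)"
  proof (rule antisymI)
    fix a b assume ab: "(a, b) \<in> map_prod f f ` r" "(b, a) \<in> map_prod f f ` r"
    with s obtain x y where xy: "x \<in> A" "y \<in> A" "a = f x" "b = f y" by blast
    with ab m have "(x, y) \<in> r" "(y, x) \<in> r" by auto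
    then show "a = b" using antisymD[OF r(4)] xy by auto
  qed
  ultimately show ?thesis
    using s by (simp add: order_on_defs refl_on_def total_on_def m r(2)) (metis m r(5))
qed

lemma e_fun_iso:
  assumes "wf_digraph K" "wf_digraph L" "bij_betw f (verts K) (verts L)" "arcs L = arcs K"
    and "\<And>a. a \<in> arcs K \<Longrightarrow> tail L a = f (tail K a) \<and> head L a = f (head K a)"
  shows "e_fun K = e_fun L"
proof -
  interpret K: wf_digraph K by fact
  interpret L: wf_digraph L by fact
  let ?g = "inv_into (verts K) f"
  have f: "inj_on f (verts K)" "f ` verts K = verts L"
    using assms(3) by (auto simp: bij_betw_def)
  have g: "inj_on ?g (verts L)" "?g ` verts L = verts K"
    using bij_betw_inv_into[OF assms(3)] by (auto simp: bij_betw_def)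
  have gf: "\<And>x. x \<in> verts K \<Longrightarrow> ?g (f x) = x" and fg: "\<And>y. y \<in> verts L \<Longrightarrow> f (?g y) = y"
    using f by (auto simp: inv_into_f_f f_inv_into_f)
  have field: "r \<subseteq> verts M \<times> verts M" if "r \<in> compatible_orders M" for r and M :: "('x, 'y) pre_digraph"
    using that by (rule compatible_order_subset)
  have inv: "map_prod h' h' ` map_prod h h ` r = r" if "r \<subseteq> A \<times> A" "\<And>x. x \<in> A \<Longrightarrow> h' (h x) = x"
    for r :: "('x \<times> 'x) set" and A and h :: "'x \<Rightarrow> 'y" and h'
  proof -
    have "map_prod h' h' (map_prod h h p) = p" if "p \<in> r" for p
      using that \<open>r \<subseteq> A \<times> A\<close> \<open>\<And>x. x \<in> A \<Longrightarrow> h' (h x) = x\<close> by (cases p) auto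
    then show ?thesis by (force simp: image_image)
  qed
  have "bij_betw (\<lambda>r. map_prod f f ` r) (compatible_orders K) (compatible_orders L)"
  proof (rule bij_betw_byWitness[where f' = "\<lambda>r. map_prod ?g ?g ` r"])
    show "\<forall>r\<in>compatible_orders K. map_prod ?g ?g ` map_prod f f ` r = r"
      using inv[of _ "verts K" ?g f, OF field gf] by blast
    show "\<forall>r\<in>compatible_orders L. map_prod f f ` map_prod ?g ?g ` r = r"
      using inv[of _ "verts L" f ?g, OF field fg] by blast
    show "(\<lambda>r. map_prod f f ` r) ` compatible_orders K \<subseteq> compatible_orders L"
      using linear_order_on_image[OF _ f(1)] assms(4,5)
      by (auto simp: compatible_orders_def f(2))
    have "tail K a = ?g (tail L a) \<and> head K a = ?g (head L a)" if "a \<in> arcs L" for a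
      using that assms(4,5) gf by auto
    then show "(\<lambda>r. map_prod ?g ?g ` r) ` compatible_orders L \<subseteq> compatible_orders K"
      using linear_order_on_image[OF _ g(1)] assms(4)
      by (auto simp: compatible_orders_def g(2))
  qed
  then have "card (compatible_orders K) = card (compatible_orders L)" by (rule bij_betw_same_card)
  moreover have "card (verts K) = card (verts L)" using assms(3) by (rule bij_betw_same_card)
  moreover have "tadpoles K = tadpoles L"
    using assms(4,5) f(1) by (auto simp: tadpoles_def inj_on_def)
  ultimately show ?thesis by (simp add: e_fun_eq assms(1,2))
qed

text \<open>
  Two quotients of the same vertex set \<open>V\<close>, with maps \<open>p\<close> and \<open>q\<close> that have the same fibres and
  with the same arcs up to these maps, are isomorphic. All comparisons of contractions along
  different cut-subquivers have this form.
\<close>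

lemma e_fun_quotient_cong:
  assumes "wf_digraph K" "wf_digraph L" "verts K = p ` V" "verts L = q ` V" "arcs L = arcs K"
    and "\<And>a. a \<in> arcs K \<Longrightarrow> t a \<in> V \<and> tail K a = p (t a) \<and> tail L a = q (t a)"
    and "\<And>a. a \<in> arcs K \<Longrightarrow> h a \<in> V \<and> head K a = p (h a) \<and> head L a = q (h a)"
    and "\<And>u v. u \<in> V \<Longrightarrow> v \<in> V \<Longrightarrow> p u = p v \<longleftrightarrow> q u = q v"
  shows "e_fun K = e_fun L"
proof (rule e_fun_iso)
  let ?f = "\<lambda>x. q (inv_into V p x)"
  have f: "?f (p u) = q u" if "u \<in> V" for u
    using assms(8)[OF inv_into_into[of "p u" p V] that] f_inv_into_f[of "p u" p V] that by auto
  have "inj_on ?f (p ` V)"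
    by (rule inj_onI) (use assms(8) f in auto)
  moreover have "?f ` p ` V = q ` V" using f by (auto simp: image_image)
  ultimately show "bij_betw ?f (verts K) (verts L)"
    unfolding assms(3,4) by (simp add: bij_betw_def)
  show "tail L a = ?f (tail K a) \<and> head L a = ?f (head K a)" if "a \<in> arcs K" for a
    using assms(6,7)[OF that] f by auto
qed (use assms in auto)

lemma e_fun_contract_contract:
  assumes "fin_digraph G" "A \<subseteq> arcs G" "B \<subseteq> arcs G - A"
  shows "e_fun (contract (contract G (G\<lparr>arcs := A\<rparr>)) ((contract G (G\<lparr>arcs := A\<rparr>))\<lparr>arcs := B\<rparr>))
       = e_fun (contract G (G\<lparr>arcs := A \<union> B\<rparr>))"
proof -
  interpret fin_digraph G by fact
  let ?Q = "contract G (G\<lparr>arcs := A\<rparr>)"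
  have AB: "A \<union> B \<subseteq> arcs G" using assms by auto
  have Q: "fin_digraph ?Q" by (rule fin_digraph_contract) fact+
  interpret Q: fin_digraph ?Q by fact
  have BQ: "B \<subseteq> arcs ?Q" using assms(3) by (simp add: contract_def)
  have vQ: "verts ?Q = component (G\<lparr>arcs := A\<rparr>) ` verts G"
    by (rule verts_contract) (fact | rule wf_digraph_axioms)+
  show ?thesis
  proof (rule e_fun_quotient_cong[where V = "verts G" and t = "tail G" and h = "head G"
        and p = "\<lambda>u. component (?Q\<lparr>arcs := B\<rparr>) (component (G\<lparr>arcs := A\<rparr>) u)"
        and q = "component (G\<lparr>arcs := A \<union> B\<rparr>)"])
    show "wf_digraph (contract ?Q (?Q\<lparr>arcs := B\<rparr>))"
      using fin_digraph_contract[OF Q BQ] by (rule fin_digraph.axioms)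
    show "wf_digraph (contract G (G\<lparr>arcs := A \<union> B\<rparr>))"
      using fin_digraph_contract[OF assms(1) AB] by (rule fin_digraph.axioms)
    show "verts (contract ?Q (?Q\<lparr>arcs := B\<rparr>)) =
        (\<lambda>u. component (?Q\<lparr>arcs := B\<rparr>) (component (G\<lparr>arcs := A\<rparr>) u)) ` verts G"
      using verts_contract[OF Q.wf_digraph_axioms BQ] by (simp add: vQ image_image)
    show "verts (contract G (G\<lparr>arcs := A \<union> B\<rparr>)) = component (G\<lparr>arcs := A \<union> B\<rparr>) ` verts G"
      by (rule verts_contract[OF wf_digraph_axioms AB])
    fix u v assume uv: "u \<in> verts G" "v \<in> verts G"
    have "wf_digraph (?Q\<lparr>arcs := B\<rparr>)" "wf_digraph (G\<lparr>arcs := A \<union> B\<rparr>)"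
      using wf_digraph_cut[OF Q.wf_digraph_axioms BQ] wf_digraph_cut[OF wf_digraph_axioms AB] by auto
    then show "component (?Q\<lparr>arcs := B\<rparr>) (component (G\<lparr>arcs := A\<rparr>) u) =
          component (?Q\<lparr>arcs := B\<rparr>) (component (G\<lparr>arcs := A\<rparr>) v) \<longleftrightarrow>
        component (G\<lparr>arcs := A \<union> B\<rparr>) u = component (G\<lparr>arcs := A \<union> B\<rparr>) v"
      using linked_contract_iff[OF wf_digraph_axioms assms(2,3) uv] uv
      by (simp add: component_eq_iff vQ)
  qed (auto simp: contract_def)
qed

lemma e_fun_cong:
  assumes "wf_digraph K" "wf_digraph L" "verts L = verts K" "arcs L = arcs K"
    and "\<And>a. a \<in> arcs K \<Longrightarrow> tail L a = tail K a \<and> head L a = head K a"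
  shows "e_fun K = e_fun L"
  using assms by (intro e_fun_iso[where f = "\<lambda>x. x"]) (auto simp: bij_betw_def)

lemma e_fun_tadpole:
  fixes K :: "('v, 'e) pre_digraph"
  assumes "fin_digraph K" "\<epsilon> \<in> arcs K" "tail K \<epsilon> = head K \<epsilon>"
  shows "e_fun K = - \<beta>\<^sub>- \<epsilon> * (e_fun (K\<lparr>arcs := arcs K - {\<epsilon>}\<rparr>) :: ('e, 'k::field_char_0) edge_poly)"
proof -
  interpret fin_digraph K by fact
  let ?D = "K\<lparr>arcs := arcs K - {\<epsilon>}\<rparr>"
  have wf: "wf_digraph ?D" by (rule wf_digraph_cut[OF wf_digraph_axioms]) auto
  have tad: "tadpoles ?D = tadpoles K - {\<epsilon>}" "\<epsilon> \<in> tadpoles K"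
    using assms(2,3) by (auto simp: tadpoles_def)
  have "finite (tadpoles K)" by (simp add: tadpoles_def)
  note prod.remove[OF this tad(2), of "\<lambda>\<epsilon>. - \<beta>\<^sub>- \<epsilon> :: ('e, 'k) edge_poly"]
  moreover have "compatible_orders ?D = compatible_orders K"
  proof -
    have "(tail K \<epsilon>, head K \<epsilon>) \<in> r" if "linear_order_on (verts K) r" for r
      using that assms(2,3) by (auto simp: order_on_defs refl_on_def)
    then show ?thesis unfolding compatible_orders_def by auto
  qed
  ultimately show ?thesis
    by (simp add: e_fun_eq[OF wf] e_fun_eq[OF wf_digraph_axioms] tad(1) mult.assoc)
qed

lemma Const_add: "Const (a + b) = Const a + Const b"
  by (simp add: Const_def single_add)

lemma fin_digraph_reverse_arc:
  assumes "fin_digraph G" "\<epsilon> \<in> arcs G"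
  shows "fin_digraph (reverse_arc G \<epsilon> \<epsilon>')"
proof -
  interpret fin_digraph G by fact
  show ?thesis
    using assms(2) by unfold_locales (auto simp: reverse_arc_def)
qed

text \<open>
  A linear order compatible with the other arcs contains exactly one of \<open>(tail K \<epsilon>, head K \<epsilon>)\<close> and
  \<open>(head K \<epsilon>, tail K \<epsilon>)\<close>.
\<close>

lemma e_fun_reverse_arc:
  fixes K :: "('v, 'e) pre_digraph"
  assumes "fin_digraph K" "\<epsilon> \<in> arcs K" "tail K \<epsilon> \<noteq> head K \<epsilon>" "\<epsilon>' \<notin> arcs K"
  shows "e_fun K + e_fun (reverse_arc K \<epsilon> \<epsilon>')
       = (e_fun (K\<lparr>arcs := arcs K - {\<epsilon>}\<rparr>) :: ('e, 'k::field_char_0) edge_poly)"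
proof -
  interpret fin_digraph K by fact
  let ?R = "reverse_arc K \<epsilon> \<epsilon>'" and ?D = "K\<lparr>arcs := arcs K - {\<epsilon>}\<rparr>"
  have wfD: "wf_digraph ?D" by (rule wf_digraph_cut[OF wf_digraph_axioms]) auto
  have wfR: "wf_digraph ?R"
    using fin_digraph_reverse_arc[OF assms(1,2)] by (rule fin_digraph.axioms)
  have tad: "tadpoles ?R = tadpoles K" "tadpoles ?D = tadpoles K"
    using assms by (auto simp: tadpoles_def reverse_arc_def)
  let ?P = "\<lambda>r. \<forall>a\<in>arcs K - {\<epsilon>}. (tail K a, head K a) \<in> r"
  have K: "r \<in> compatible_orders K \<longleftrightarrow> r \<in> compatible_orders ?D \<and> (tail K \<epsilon>, head K \<epsilon>) \<in> r" for r
    using assms(2) by (auto simp: compatible_orders_def)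
  have "(\<forall>a\<in>arcs ?R. (tail ?R a, head ?R a) \<in> r) \<longleftrightarrow> ?P r \<and> (head K \<epsilon>, tail K \<epsilon>) \<in> r" for r
    using assms(4) by (auto simp: reverse_arc_def)
  then have R: "r \<in> compatible_orders ?R \<longleftrightarrow> r \<in> compatible_orders ?D \<and> (head K \<epsilon>, tail K \<epsilon>) \<in> r" for r
    by (simp add: compatible_orders_def reverse_arc_def)
  have "(tail K \<epsilon>, head K \<epsilon>) \<in> r \<or> (head K \<epsilon>, tail K \<epsilon>) \<in> r" if "r \<in> compatible_orders ?D" for r
    using that assms(2,3) by (simp add: compatible_orders_def order_on_defs total_on_def)
  then have "compatible_orders ?D = compatible_orders K \<union> compatible_orders ?R"
    using K R by blast
  moreover have "compatible_orders K \<inter> compatible_orders ?R = {}"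
  proof (rule equals0I)
    fix r assume "r \<in> compatible_orders K \<inter> compatible_orders ?R"
    then have "(tail K \<epsilon>, head K \<epsilon>) \<in> r" "(head K \<epsilon>, tail K \<epsilon>) \<in> r" "r \<in> compatible_orders K"
      using K R by auto
    then show False using assms(3) antisymD[OF compatible_order_antisym] by metis
  qed
  moreover have "finite (compatible_orders K)" "finite (compatible_orders ?R)"
    by (intro finite_compatible_orders, simp add: reverse_arc_def)+
  ultimately have card: "card (compatible_orders ?D) = card (compatible_orders K) + card (compatible_orders ?R)"
    by (simp add: card_Un_disjoint)
  have v: "verts ?R = verts K" by (simp add: reverse_arc_def)
  show ?thesis
    by (simp add: e_fun_eq[OF wfD] e_fun_eq[OF wfR] e_fun_eq[OF wf_digraph_axioms] tad card v
        add_divide_distrib Const_add algebra_simps)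
qed

section \<open>Local modifications under contraction\<close>

lemma mk_symmetric_reverse_arc:
  assumes "\<epsilon> \<in> arcs G" "\<epsilon>' \<notin> arcs G"
  shows "mk_symmetric (reverse_arc G \<epsilon> \<epsilon>') = mk_symmetric G"
proof -
  have "(\<Union>a\<in>arcs G. g a) = g \<epsilon> \<union> (\<Union>a\<in>arcs G - {\<epsilon>}. g a)" for g :: "_ \<Rightarrow> (_ \<times> _) set"
    using assms(1) by blast
  note this[of "\<lambda>a. {(tail G a, head G a), (head G a, tail G a)}"]
  moreover have "(\<Union>a\<in>arcs G - {\<epsilon>}. {(tail (reverse_arc G \<epsilon> \<epsilon>') a, head (reverse_arc G \<epsilon> \<epsilon>') a),
        (head (reverse_arc G \<epsilon> \<epsilon>') a, tail (reverse_arc G \<epsilon> \<epsilon>') a)})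
      = (\<Union>a\<in>arcs G - {\<epsilon>}. {(tail G a, head G a), (head G a, tail G a)})"
    using assms(2) by (intro SUP_cong) (auto simp: reverse_arc_def)
  ultimately show ?thesis
    by (simp add: mk_symmetric_def) (auto simp: reverse_arc_def)
qed

lemma mk_symmetric_cong:
  assumes "verts H = verts G" "arcs H = arcs G"
    and "\<And>a. a \<in> arcs G \<Longrightarrow> tail H a = tail G a \<and> head H a = head G a"
  shows "mk_symmetric H = mk_symmetric G"
proof -
  have "(\<Union>a\<in>arcs H. {(tail H a, head H a), (head H a, tail H a)})
      = (\<Union>a\<in>arcs G. {(tail G a, head G a), (head G a, tail G a)})"
    using assms(2,3) by (intro SUP_cong) auto
  then show ?thesis by (simp add: mk_symmetric_def assms(1))
qed

lemma reverse_arc_cut: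
  assumes "\<epsilon> \<notin> F"
  shows "(reverse_arc G \<epsilon> \<epsilon>')\<lparr>arcs := insert \<epsilon>' F\<rparr> = reverse_arc (G\<lparr>arcs := insert \<epsilon> F\<rparr>) \<epsilon> \<epsilon>'"
  using assms by (simp add: reverse_arc_def)

lemma contract_arc_cut:
  assumes "\<epsilon> \<notin> F"
  shows "(contract_arc G \<epsilon>)\<lparr>arcs := F\<rparr> = contract_arc (G\<lparr>arcs := insert \<epsilon> F\<rparr>) \<epsilon>"
  using assms by (simp add: contract_arc_def contract_def)

lemma contract_reverse_arc:
  assumes "\<epsilon> \<in> arcs G" "\<epsilon>' \<notin> arcs G" "F \<subseteq> arcs G - {\<epsilon>}"
  shows "contract (reverse_arc G \<epsilon> \<epsilon>') ((reverse_arc G \<epsilon> \<epsilon>')\<lparr>arcs := F\<rparr>)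
       = reverse_arc (contract G (G\<lparr>arcs := F\<rparr>)) \<epsilon> \<epsilon>'"
proof -
  have "mk_symmetric ((reverse_arc G \<epsilon> \<epsilon>')\<lparr>arcs := F\<rparr>) = mk_symmetric (G\<lparr>arcs := F\<rparr>)"
    using assms(2,3) by (intro mk_symmetric_cong) (auto simp: reverse_arc_def)
  moreover have "insert \<epsilon>' (arcs G - {\<epsilon>}) - F = insert \<epsilon>' (arcs G - F - {\<epsilon>})"
    using assms by auto
  ultimately show ?thesis
    by (auto simp: contract_def reverse_arc_def fun_eq_iff)
qed

lemma e_fun_contract_reverse_arc:
  assumes "fin_digraph G" "\<epsilon> \<in> arcs G" "\<epsilon>' \<notin> arcs G" "F \<subseteq> arcs G - {\<epsilon>}"
  shows "e_fun (contract (reverse_arc G \<epsilon> \<epsilon>') (reverse_arc (G\<lparr>arcs := insert \<epsilon> F\<rparr>) \<epsilon> \<epsilon>'))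
       = e_fun (contract G (G\<lparr>arcs := insert \<epsilon> F\<rparr>))"
proof -
  let ?R = "reverse_arc G \<epsilon> \<epsilon>'"
  have F: "\<epsilon> \<notin> F" "\<epsilon>' \<notin> F" using assms(3,4) by auto
  have fR: "fin_digraph ?R" by (rule fin_digraph_reverse_arc) fact+
  have "fin_digraph (contract ?R (?R\<lparr>arcs := insert \<epsilon>' F\<rparr>))"
    using assms(4) by (intro fin_digraph_contract[OF fR]) (auto simp: reverse_arc_def)
  then have wf: "wf_digraph (contract ?R (reverse_arc (G\<lparr>arcs := insert \<epsilon> F\<rparr>) \<epsilon> \<epsilon>'))"
    unfolding reverse_arc_cut[OF F(1)] by (rule fin_digraph.axioms)
  have "fin_digraph (contract G (G\<lparr>arcs := insert \<epsilon> F\<rparr>))"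
    using assms(2,4) by (intro fin_digraph_contract[OF assms(1)]) auto
  then have wf': "wf_digraph (contract G (G\<lparr>arcs := insert \<epsilon> F\<rparr>))" by (rule fin_digraph.axioms)
  have m: "mk_symmetric (reverse_arc (G\<lparr>arcs := insert \<epsilon> F\<rparr>) \<epsilon> \<epsilon>') = mk_symmetric (G\<lparr>arcs := insert \<epsilon> F\<rparr>)"
    using F assms(2,3) by (intro mk_symmetric_reverse_arc) auto
  show ?thesis
    using F assms(2,3)
    by (intro e_fun_cong wf wf') (auto simp: contract_def m, auto simp: reverse_arc_def)
qed

lemma e_fun_contract_insert_redundant:
  fixes G :: "('v, 'e) pre_digraph"
  assumes "fin_digraph G" "\<epsilon> \<in> arcs G" "F \<subseteq> arcs G - {\<epsilon>}"
    and "linked (G\<lparr>arcs := F\<rparr>) (tail G \<epsilon>) (head G \<epsilon>)"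
  shows "e_fun (contract (G\<lparr>arcs := arcs G - {\<epsilon>}\<rparr>) (G\<lparr>arcs := F\<rparr>))
       = (e_fun (contract G (G\<lparr>arcs := insert \<epsilon> F\<rparr>)) :: ('e, 'k::field_char_0) edge_poly)"
proof -
  interpret fin_digraph G by fact
  let ?D = "G\<lparr>arcs := arcs G - {\<epsilon>}\<rparr>"
  have fD: "fin_digraph ?D" by (rule fin_digraph_cut[OF assms(1)]) auto
  have F: "F \<subseteq> arcs G" "insert \<epsilon> F \<subseteq> arcs G" "F \<subseteq> arcs ?D" using assms(2,3) by auto
  note wf = wf_digraph_cut[OF wf_digraph_axioms F(1)] wf_digraph_cut[OF wf_digraph_axioms F(2)]
  show ?thesis
  proof (rule e_fun_quotient_cong[where V = "verts G" and t = "tail G" and h = "head G"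
        and p = "component (G\<lparr>arcs := F\<rparr>)" and q = "component (G\<lparr>arcs := insert \<epsilon> F\<rparr>)"])
    show "wf_digraph (contract ?D (G\<lparr>arcs := F\<rparr>))"
      using fin_digraph_contract[OF fD F(3)] by (simp add: fin_digraph.axioms)
    show "wf_digraph (contract G (G\<lparr>arcs := insert \<epsilon> F\<rparr>))"
      using fin_digraph_contract[OF assms(1) F(2)] by (rule fin_digraph.axioms)
    show "verts (contract ?D (G\<lparr>arcs := F\<rparr>)) = component (G\<lparr>arcs := F\<rparr>) ` verts G"
      using verts_contract[OF wf_digraph_axioms F(1)] by (simp add: contract_def)
    show "verts (contract G (G\<lparr>arcs := insert \<epsilon> F\<rparr>)) = component (G\<lparr>arcs := insert \<epsilon> F\<rparr>) ` verts G"
      by (rule verts_contract[OF wf_digraph_axioms F(2)])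
    fix u v assume "u \<in> verts G" "v \<in> verts G"
    then show "component (G\<lparr>arcs := F\<rparr>) u = component (G\<lparr>arcs := F\<rparr>) v \<longleftrightarrow>
        component (G\<lparr>arcs := insert \<epsilon> F\<rparr>) u = component (G\<lparr>arcs := insert \<epsilon> F\<rparr>) v"
      using linked_insert_redundant[OF wf_digraph_axioms F(1) assms(2,4)]
      by (simp add: component_eq_iff wf)
  qed (auto simp: contract_def)
qed

text \<open>
  The contribution of a set \<open>F\<close> of arcs other than \<open>\<epsilon>\<close>. In the contraction by \<open>F\<close>, the arc \<open>\<epsilon>\<close> is a
  tadpole iff \<open>F\<close> joins its endpoints; the right-hand side then is \<open>1 - (\<beta> \<epsilon> + \<beta> \<epsilon>')/2\<close> times
  \<open>e\<close> of the contraction by \<open>F\<close> with \<open>\<epsilon>\<close> deleted.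
\<close>

lemma e_fun_contract_sum:
  fixes G :: "('v, 'e) pre_digraph"
  assumes "fin_digraph G" "\<epsilon> \<in> arcs G" "tail G \<epsilon> \<noteq> head G \<epsilon>" "\<epsilon>' \<notin> arcs G" "F \<subseteq> arcs G - {\<epsilon>}"
  defines "R \<equiv> reverse_arc G \<epsilon> \<epsilon>'"
  shows "e_fun (contract G (G\<lparr>arcs := F\<rparr>)) + e_fun (contract R (R\<lparr>arcs := F\<rparr>))
       = e_fun (contract (G\<lparr>arcs := arcs G - {\<epsilon>}\<rparr>) (G\<lparr>arcs := F\<rparr>))
         - (if linked (G\<lparr>arcs := F\<rparr>) (tail G \<epsilon>) (head G \<epsilon>)
            then Const (1 / 2) * (\<beta> \<epsilon> + \<beta> \<epsilon>') * e_fun (contract G (G\<lparr>arcs := insert \<epsilon> F\<rparr>))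
            else (0 :: ('e, 'k::field_char_0) edge_poly))"
proof -
  interpret fin_digraph G by fact
  have F: "F \<subseteq> arcs G" using assms(5) by auto
  define K where "K = contract G (G\<lparr>arcs := F\<rparr>)"
  have fK: "fin_digraph K" unfolding K_def by (rule fin_digraph_contract) fact+
  have K: "\<epsilon> \<in> arcs K" "\<epsilon>' \<notin> arcs K" "\<epsilon> \<noteq> \<epsilon>'" "\<epsilon>' \<notin> F"
    using assms(2,4,5) by (auto simp: K_def contract_def)
  have th: "tail K \<epsilon> = head K \<epsilon> \<longleftrightarrow> linked (G\<lparr>arcs := F\<rparr>) (tail G \<epsilon>) (head G \<epsilon>)"
    using assms(2) component_eq_iff[OF wf_digraph_cut[OF wf_digraph_axioms F], of "head G \<epsilon>" "tail G \<epsilon>"]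
    by (simp add: K_def contract_def)
  have D: "contract (G\<lparr>arcs := arcs G - {\<epsilon>}\<rparr>) (G\<lparr>arcs := F\<rparr>) = K\<lparr>arcs := arcs K - {\<epsilon>}\<rparr>"
    by (auto simp: K_def contract_def)
  have R: "contract R (R\<lparr>arcs := F\<rparr>) = reverse_arc K \<epsilon> \<epsilon>'"
    unfolding R_def K_def by (rule contract_reverse_arc) fact+
  have fR: "fin_digraph (reverse_arc K \<epsilon> \<epsilon>')" by (rule fin_digraph_reverse_arc) fact+
  show ?thesis
  proof (cases "linked (G\<lparr>arcs := F\<rparr>) (tail G \<epsilon>) (head G \<epsilon>)")
    case False
    then show ?thesis
      using e_fun_reverse_arc[OF fK K(1) _ K(2), where 'k = 'k] th unfolding R D by (simp add: K_def)
  next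
    case True
    let ?D = "K\<lparr>arcs := arcs K - {\<epsilon>}\<rparr>" and ?R = "reverse_arc K \<epsilon> \<epsilon>'"
    have eK: "e_fun K = - \<beta>\<^sub>- \<epsilon> * (e_fun ?D :: ('e, 'k) edge_poly)"
      using True th by (intro e_fun_tadpole[OF fK K(1)]) simp
    have eR: "e_fun ?R = - \<beta>\<^sub>- \<epsilon>' * (e_fun (?R\<lparr>arcs := arcs ?R - {\<epsilon>'}\<rparr>) :: ('e, 'k) edge_poly)"
      using True th by (intro e_fun_tadpole[OF fR]) (auto simp: reverse_arc_def)
    have "wf_digraph ?D" "wf_digraph (?R\<lparr>arcs := arcs ?R - {\<epsilon>'}\<rparr>)"
      using fin_digraph.axioms(1)[OF fK] fin_digraph.axioms(1)[OF fR]
      by (auto intro!: wf_digraph_cut)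
    then have "e_fun ?D = (e_fun (?R\<lparr>arcs := arcs ?R - {\<epsilon>'}\<rparr>) :: ('e, 'k) edge_poly)"
      by (rule e_fun_cong) (use K(2) in \<open>auto simp: reverse_arc_def\<close>)
    note eR[folded this]
    moreover have "e_fun ?D = (e_fun (contract G (G\<lparr>arcs := insert \<epsilon> F\<rparr>)) :: ('e, 'k) edge_poly)"
      using e_fun_contract_insert_redundant[OF assms(1,2,5) True] unfolding D .
    moreover have "- \<beta>\<^sub>- \<epsilon> - \<beta>\<^sub>- \<epsilon>' = 1 - Const (1 / 2) * (\<beta> \<epsilon> + \<beta> \<epsilon>' :: ('e, 'k) edge_poly)"
    proof -
      have "Const (1 / 2) + Const (1 / 2) = (1 :: ('e, 'k) edge_poly)"
        by (simp add: Const_def flip: single_add)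
      then show ?thesis by (simp add: edge_param_minus_def algebra_simps)
    qed
    then have "(- \<beta>\<^sub>- \<epsilon> - \<beta>\<^sub>- \<epsilon>') * x = (1 - Const (1 / 2) * (\<beta> \<epsilon> + \<beta> \<epsilon>')) * x"
      for x :: "('e, 'k) edge_poly" by simp
    ultimately have "e_fun K + e_fun ?R = (1 - Const (1 / 2) * (\<beta> \<epsilon> + \<beta> \<epsilon>'))
        * (e_fun (contract G (G\<lparr>arcs := insert \<epsilon> F\<rparr>)) :: ('e, 'k) edge_poly)"
      using eK by (simp add: left_diff_distrib)
    then show ?thesis
      using True e_fun_contract_insert_redundant[OF assms(1,2,5) True, where 'k = 'k]
      unfolding R by (simp add: K_def left_diff_distrib)
  qed
qed

section \<open>The function \<open>\<omega>\<close>\<close>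

lemma omega_equation:
  assumes "fin_digraph G"
  shows "(\<Sum>F\<in>Pow (arcs G). \<omega> (G\<lparr>arcs := F\<rparr>) * e_fun (contract G (G\<lparr>arcs := F\<rparr>))) = counit G"
proof -
  have inj: "inj_on (\<lambda>F. G\<lparr>arcs := F\<rparr>) (Pow (arcs G))"
    by (rule inj_onI) (metis pre_digraph.select_convs(2) pre_digraph.surjective pre_digraph.update_convs(2))
  have "(\<Sum>H | H \<preceq>\<^sub>c G. \<omega> H * e_fun (contract G H)) = counit G"
    using is_omega_omega assms unfolding is_omega_def by blast
  then show ?thesis
    unfolding cut_subquivers_eq[OF assms] by (simp add: sum.reindex[OF inj])
qed

lemma e_fun_contract_self_cancel:
  fixes x :: "('e, 'k::field_char_0) edge_poly"
  assumes "fin_digraph G" "x * e_fun (contract G G) = y * e_fun (contract G G)"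
  shows "x = y"
proof -
  obtain i where i: "(e_fun (contract G G) :: ('e, 'k) edge_poly) * i = 1"
    using e_fun_contract_self_unit[OF assms(1)] .
  have "x * (e_fun (contract G G) * i) = y * (e_fun (contract G G) * i)"
    using assms(2) by (simp flip: mult.assoc)
  then show ?thesis by (simp add: i)
qed

text \<open>
  The value of \<open>\<omega>\<close> ignores what \<open>tail\<close> and \<open>head\<close> do outside the arc set. This is needed because
  \<open>reverse_arc\<close> changes both functions at \<open>\<epsilon>'\<close>, also for cut-subquivers without \<open>\<epsilon>'\<close>.
\<close>

lemma omega_cong:
  fixes G H :: "('v, 'e) pre_digraph"
  assumes "fin_digraph G" "fin_digraph H" "verts H = verts G" "arcs H = arcs G"
    and "\<And>a. a \<in> arcs G \<Longrightarrow> tail H a = tail G a \<and> head H a = head G a"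
  shows "\<omega> G = (\<omega> H :: ('e, 'k::field_char_0) edge_poly)"
  using assms
proof (induct "card (arcs G)" arbitrary: G H rule: less_induct)
  case less
  interpret fin_digraph G by fact
  have m: "mk_symmetric (H\<lparr>arcs := F\<rparr>) = mk_symmetric (G\<lparr>arcs := F\<rparr>)" if "F \<subseteq> arcs G" for F
    using that less.prems by (intro mk_symmetric_cong) auto
  have e: "e_fun (contract G (G\<lparr>arcs := F\<rparr>)) = (e_fun (contract H (H\<lparr>arcs := F\<rparr>)) :: ('e, 'k) edge_poly)"
    if "F \<subseteq> arcs G" for F
    using that less.prems
    by (intro e_fun_cong fin_digraph.axioms(1) fin_digraph_contract) (simp_all add: contract_def m)
  have w: "\<omega> (G\<lparr>arcs := F\<rparr>) = (\<omega> (H\<lparr>arcs := F\<rparr>) :: ('e, 'k) edge_poly)" if "F \<subset> arcs G" for F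
    using that less.prems psubset_card_mono[OF finite_arcs that]
    by (intro less.hyps fin_digraph_cut) auto
  let ?f = "\<lambda>K F. \<omega> (K\<lparr>arcs := F\<rparr>) * (e_fun (contract K (K\<lparr>arcs := F\<rparr>)) :: ('e, 'k) edge_poly)"
  have split: "sum f (Pow (arcs G)) = f (arcs G) + sum f (Pow (arcs G) - {arcs G})" for f :: "_ \<Rightarrow> ('e, 'k) edge_poly"
    by (intro sum.remove) auto
  have "sum (?f G) (Pow (arcs G)) = sum (?f H) (Pow (arcs G))"
    using omega_equation[OF less.prems(1), where 'c = 'k] omega_equation[OF less.prems(2), where 'c = 'k] less.prems(4)
    by (simp add: counit_def)
  moreover have "sum (?f G) (Pow (arcs G) - {arcs G}) = sum (?f H) (Pow (arcs G) - {arcs G})"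
    by (intro sum.cong refl) (auto simp: w e psubset_eq)
  ultimately have "?f G (arcs G) = ?f H (arcs G)"
    unfolding split by simp
  moreover have "H\<lparr>arcs := arcs G\<rparr> = H" "G\<lparr>arcs := arcs G\<rparr> = G" using less.prems(4) by simp_all
  ultimately have "\<omega> G * e_fun (contract G G) = \<omega> H * (e_fun (contract G G) :: ('e, 'k) edge_poly)"
    using e[of "arcs G"] by simp
  then show ?case by (rule e_fun_contract_self_cancel[OF less.prems(1)])
qed

section \<open>The relation for \<open>\<omega>\<close>\<close>

lemma sum_Pow_insert:
  assumes "finite A" "a \<notin> A"
  shows "sum f (Pow (insert a A)) = (\<Sum>F\<in>Pow A. f F + f (insert a F))"
proof -
  have "inj_on (insert a) (Pow A)" using assms(2) by (auto simp: inj_on_def insert_ident)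
  moreover have "Pow A \<inter> insert a ` Pow A = {}" using assms(2) by auto
  ultimately show ?thesis
    using assms(1) by (simp add: Pow_insert sum.union_disjoint sum.reindex sum.distrib)
qed

text \<open>
  In contrast to the relation for \<open>\<omega>\<^sub>c\<close>, that for \<open>\<omega>\<close> also holds for disconnected \<open>G\<close>; the condition
  on the right-hand side only concerns the endpoints of \<open>\<epsilon>\<close>.
\<close>

lemma omega_arc_relation:
  fixes G :: "('v, 'e) pre_digraph"
  assumes "fin_digraph G" "\<epsilon> \<in> arcs G" "tail G \<epsilon> \<noteq> head G \<epsilon>" "\<epsilon>' \<notin> arcs G"
  shows "\<omega> G + \<omega> (reverse_arc G \<epsilon> \<epsilon>') + \<omega> (contract_arc G \<epsilon>)
       = (if linked (G\<lparr>arcs := arcs G - {\<epsilon>}\<rparr>) (tail G \<epsilon>) (head G \<epsilon>)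
          then Const (1 / 2) * (\<beta> \<epsilon> + \<beta> \<epsilon>') * \<omega> (G\<lparr>arcs := arcs G - {\<epsilon>}\<rparr>)
          else (0 :: ('e, 'k::field_char_0) edge_poly))"
  using assms
proof (induct "card (arcs G)" arbitrary: G rule: less_induct)
  case less
  interpret fin_digraph G by fact
  define B where "B = arcs G - {\<epsilon>}"
  define D where "D = G\<lparr>arcs := B\<rparr>"
  define R where "R = reverse_arc G \<epsilon> \<epsilon>'"
  define Q where "Q = contract_arc G \<epsilon>"
  define c :: "('e, 'k) edge_poly" where "c = Const (1 / 2) * (\<beta> \<epsilon> + \<beta> \<epsilon>')"
  let ?i = "tail G \<epsilon>" and ?j = "head G \<epsilon>"
  let ?G = "\<lambda>F. G\<lparr>arcs := F\<rparr>" and ?G' = "\<lambda>F. G\<lparr>arcs := insert \<epsilon> F\<rparr>"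
  let ?e = "\<lambda>F. e_fun (contract G (?G' F)) :: ('e, 'k) edge_poly"
  define X where "X F = \<omega> (?G' F) + \<omega> (reverse_arc (?G' F) \<epsilon> \<epsilon>') + \<omega> (contract_arc (?G' F) \<epsilon>)
      - (if linked (?G F) ?i ?j then c * \<omega> (?G F) else 0)" for F
  have B: "finite B" "\<epsilon> \<notin> B" "\<epsilon>' \<notin> B" "arcs G = insert \<epsilon> B"
    using less.prems(2,4) by (auto simp: B_def)
  have fD: "fin_digraph D" unfolding D_def B_def by (rule fin_digraph_cut[OF less.prems(1)]) auto
  have fR: "fin_digraph R" unfolding R_def by (rule fin_digraph_reverse_arc) fact+
  have fQ: "fin_digraph Q" unfolding Q_def contract_arc_def
    using less.prems(2) by (intro fin_digraph_contract[OF less.prems(1)]) auto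
  have arcs: "arcs R = insert \<epsilon>' B" "arcs Q = B" "arcs D = B"
    by (auto simp: R_def Q_def D_def B_def reverse_arc_def contract_arc_def contract_def)

  \<comment> \<open>The defining equations at the four quivers, as sums over the arc sets of \<open>D\<close>. \<open>D\<close> and \<open>Q\<close> have
    the same arcs, hence the same counit.\<close>
  have eqG: "(\<Sum>F\<in>Pow B. \<omega> (?G F) * e_fun (contract G (?G F)) + \<omega> (?G' F) * ?e F) = 0"
    using omega_equation[OF less.prems(1), where 'c = 'k]
      sum_Pow_insert[OF B(1,2), of "\<lambda>F. \<omega> (?G F) * e_fun (contract G (?G F)) :: ('e, 'k) edge_poly"]
    by (simp add: B(4) counit_def)
  have "(\<Sum>F\<in>Pow B. \<omega> (R\<lparr>arcs := F\<rparr>) * e_fun (contract R (R\<lparr>arcs := F\<rparr>))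
      + \<omega> (R\<lparr>arcs := insert \<epsilon>' F\<rparr>) * e_fun (contract R (R\<lparr>arcs := insert \<epsilon>' F\<rparr>))) = (0 :: ('e, 'k) edge_poly)"
    using omega_equation[OF fR, where 'c = 'k]
      sum_Pow_insert[OF B(1,3), of "\<lambda>F. \<omega> (R\<lparr>arcs := F\<rparr>) * e_fun (contract R (R\<lparr>arcs := F\<rparr>)) :: ('e, 'k) edge_poly"]
    by (simp add: arcs counit_def)
  moreover have "\<omega> (R\<lparr>arcs := F\<rparr>) = (\<omega> (?G F) :: ('e, 'k) edge_poly)" if "F \<in> Pow B" for F
    using that B by (intro omega_cong fin_digraph_cut fR less.prems(1))
      (auto simp: arcs, auto simp: R_def reverse_arc_def)
  moreover have "R\<lparr>arcs := insert \<epsilon>' F\<rparr> = reverse_arc (?G' F) \<epsilon> \<epsilon>'" if "F \<in> Pow B" for F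
    unfolding R_def using that B(2) by (intro reverse_arc_cut) auto
  moreover have "e_fun (contract R (reverse_arc (?G' F) \<epsilon> \<epsilon>')) = ?e F" if "F \<in> Pow B" for F
    unfolding R_def using that by (intro e_fun_contract_reverse_arc less.prems) (auto simp: B_def)
  ultimately have eqR: "(\<Sum>F\<in>Pow B. \<omega> (?G F) * e_fun (contract R (R\<lparr>arcs := F\<rparr>))
      + \<omega> (reverse_arc (?G' F) \<epsilon> \<epsilon>') * ?e F) = 0"
    by simp
  have "(\<Sum>F\<in>Pow B. \<omega> (Q\<lparr>arcs := F\<rparr>) * e_fun (contract Q (Q\<lparr>arcs := F\<rparr>))) = (counit Q :: ('e, 'k) edge_poly)"
    using omega_equation[OF fQ] by (simp add: arcs)
  moreover have "Q\<lparr>arcs := F\<rparr> = contract_arc (?G' F) \<epsilon>" if "F \<in> Pow B" for F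
    unfolding Q_def using that B(2) by (intro contract_arc_cut) auto
  moreover have "e_fun (contract Q (Q\<lparr>arcs := F\<rparr>)) = ?e F" if "F \<in> Pow B" for F
    using e_fun_contract_contract[OF less.prems(1), of "{\<epsilon>}" F] that less.prems(2)
    by (auto simp: Q_def contract_arc_def B_def)
  ultimately have eqQ: "(\<Sum>F\<in>Pow B. \<omega> (contract_arc (?G' F) \<epsilon>) * ?e F) = counit Q"
    by simp
  have eqD: "(\<Sum>F\<in>Pow B. \<omega> (?G F) * e_fun (contract D (?G F))) = (counit Q :: ('e, 'k) edge_poly)"
    using omega_equation[OF fD, where 'c = 'k] arcs by (simp add: D_def counit_def)

  have e: "e_fun (contract G (?G F)) + e_fun (contract R (R\<lparr>arcs := F\<rparr>))
      = e_fun (contract D (?G F)) - (if linked (?G F) ?i ?j then c * ?e F else 0)" if "F \<in> Pow B" for F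
    using e_fun_contract_sum[OF less.prems, of F, where 'k = 'k] that
    by (simp add: R_def D_def B_def c_def)
  have X: "X F * ?e F = (\<omega> (?G F) * e_fun (contract G (?G F)) + \<omega> (?G' F) * ?e F)
      + (\<omega> (?G F) * e_fun (contract R (R\<lparr>arcs := F\<rparr>)) + \<omega> (reverse_arc (?G' F) \<epsilon> \<epsilon>') * ?e F)
      + \<omega> (contract_arc (?G' F) \<epsilon>) * ?e F - \<omega> (?G F) * e_fun (contract D (?G F))"
    if "F \<in> Pow B" for F
  proof -
    have "\<omega> (?G F) * e_fun (contract G (?G F)) + \<omega> (?G F) * e_fun (contract R (R\<lparr>arcs := F\<rparr>))
        - \<omega> (?G F) * e_fun (contract D (?G F)) = - (if linked (?G F) ?i ?j then c * \<omega> (?G F) else 0) * ?e F"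
      unfolding distrib_left[symmetric] e[OF that] by (simp add: algebra_simps)
    then show ?thesis by (simp add: X_def algebra_simps)
  qed
  have "(\<Sum>F\<in>Pow B. X F * ?e F) = 0"
    using eqG eqR eqQ eqD by (simp add: X sum.distrib sum_subtractf)
  moreover have "X F = 0" if "F \<in> Pow B - {B}" for F
  proof -
    have F: "F \<subset> B" "\<epsilon> \<notin> F" using that B(2) by auto
    then have "card (arcs (?G' F)) < card (arcs G)"
      using psubset_card_mono[OF B(1) F(1)] finite_subset[OF _ B(1), of F] B by simp
    moreover have "fin_digraph (?G' F)"
      using F(1) B(4) by (intro fin_digraph_cut[OF less.prems(1)]) auto
    moreover have "\<epsilon>' \<notin> insert \<epsilon> F" using F(1) less.prems(4) B(4) by auto
    ultimately show ?thesis
      using less.hyps[of "?G' F"] F(2) less.prems(3) by (simp add: X_def c_def)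
  qed
  \<comment> \<open>Only the term of the full arc set is left, and \<open>B\<close> with \<open>\<epsilon>\<close> spans \<open>G\<close> itself.\<close>
  ultimately have "X B * ?e B = 0"
    using sum.remove[of "Pow B" B "\<lambda>F. X F * ?e F"] B(1) by simp
  moreover have "?G' B = G" using B(4) by simp
  ultimately have "X B = 0"
    using e_fun_contract_self_cancel[OF less.prems(1), of "X B" 0] by simp
  then show ?case
    using \<open>?G' B = G\<close> by (simp add: X_def c_def B_def)
qed

lemma connected_iff_linked:
  "Digraph_Component.connected G \<longleftrightarrow> verts G \<noteq> {} \<and> (\<forall>u\<in>verts G. \<forall>v\<in>verts G. linked G u v)"
  by (simp add: Digraph_Component.connected_def strongly_connected_def)

theorem theorem4p5:
  fixes G :: "('v, 'e) pre_digraph" and \<epsilon> \<epsilon>' :: 'e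
  assumes "fin_digraph G"
    and "\<epsilon> \<in> arcs G" and "tail G \<epsilon> \<noteq> head G \<epsilon>"
    and "\<epsilon>' \<notin> arcs G"
  shows "\<omega>\<^sub>c G + \<omega>\<^sub>c (reverse_arc G \<epsilon> \<epsilon>') + \<omega>\<^sub>c (contract_arc G \<epsilon>)
       = Const (1 / 2) * (\<beta> \<epsilon> + \<beta> \<epsilon>') * (\<omega>\<^sub>c (pre_digraph.del_arc G \<epsilon>)
           :: ('e, 'k::field_char_0) edge_poly)"
proof -
  interpret fin_digraph G by fact
  let ?B = "arcs G - {\<epsilon>}"
  let ?D = "G\<lparr>arcs := ?B\<rparr>" and ?C = "component (G\<lparr>arcs := {\<epsilon>}\<rparr>)" and ?Q = "contract_arc G \<epsilon>"
  have D: "pre_digraph.del_arc G \<epsilon> = ?D" by (simp add: pre_digraph.del_arc_def)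
  have GB: "G\<lparr>arcs := insert \<epsilon> ?B\<rparr> = G" using assms(2) by (simp add: insert_absorb)
  have cR: "Digraph_Component.connected (reverse_arc G \<epsilon> \<epsilon>') \<longleftrightarrow> Digraph_Component.connected G"
    by (simp add: Digraph_Component.connected_def mk_symmetric_reverse_arc assms)
  have Q: "?Q\<lparr>arcs := ?B\<rparr> = ?Q" "verts ?Q = ?C ` verts G"
    using verts_contract[OF wf_digraph_axioms, of "{\<epsilon>}"] assms(2)
    by (simp_all add: contract_arc_def contract_def)
  have "linked ?Q (?C u) (?C v) \<longleftrightarrow> linked G u v" if "u \<in> verts G" "v \<in> verts G" for u v
    using linked_contract_iff[OF wf_digraph_axioms, of "{\<epsilon>}" ?B u v] that assms(2) GB Q(1)
    by (simp add: contract_arc_def)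
  then have cQ: "Digraph_Component.connected ?Q \<longleftrightarrow> Digraph_Component.connected G"
    by (simp add: connected_iff_linked Q(2))
  have cD: "Digraph_Component.connected ?D \<longleftrightarrow>
      Digraph_Component.connected G \<and> linked ?D (tail G \<epsilon>) (head G \<epsilon>)"
  proof (cases "linked ?D (tail G \<epsilon>) (head G \<epsilon>)")
    case True
    have "linked G u v \<longleftrightarrow> linked ?D u v" for u v
      using linked_insert_redundant[OF wf_digraph_axioms _ assms(2) True, of u v] GB by simp
    with True show ?thesis by (simp add: connected_iff_linked)
  next
    case False
    then show ?thesis using assms(2) by (auto simp: connected_iff_linked)
  qed
  show ?thesis
    using omega_arc_relation[OF assms, where 'k = 'k] by (simp add: omega_c_def D cR cQ cD)
qed

end
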